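(* Let $R$ be a reduced commutative ring. Then the algebra $\mathbb{F}_{cm}(R)$ of common cancellation fractions over $R$ is a common meadow.
   Context: A commutative ring (with $1$) $R$ is reduced if $x\cdot x=0$ implies $x=0$ for all $x\in R$. A fracpair over $R$ is an element of $F(R)=R\times R$, written $\frac pq$ (also $p/q$), with no restriction on $q$ (so $q=0$ is allowed). Cc-equivalence $=_{cc}$ is the smallest equivalence relation on $F(R)$ such that $\frac{x\cdot z}{y\cdot(z\cdot z)}=_{cc}\frac{x}{y\cdot z}$ for all $x,y,z\in R$. Let $\Sigma_{cm}=\{0,1,\mathbf a,-(\_),(\_)^{-1},+,\cdot\}$ (three constants, two unary and two binary operations). On $F(R)$ these are defined by: $\frac xy+\frac uv=\frac{x\cdot v+u\cdot y}{y\cdot v}$, $\frac xy\cdot\frac uv=\frac{x\cdot u}{y\cdot v}$, $-\frac xy=\frac{-x}{y}$, $\left(\frac xy\right)^{-1}=\frac{y\cdot y}{x\cdot y}$, $0=\frac01$, $1=\frac11$, $\mathbf a=\frac10$. The relation $=_{cc}$ is a congruence for these operations, and $\mathbb{F}_{cm}(R)$ is the quotient $\Sigma_{cm}$-algebra $F(R)/{=_{cc}}$. A common meadow is a $\Sigma_{cm}$-algebra satisfying, for all $x,y,z$, the axioms: $(x+y)+z=x+(y+z)$; $x+y=y+x$; $x+0=x$; $x+(-x)=0\cdot x$; $(x\cdot y)\cdot z=x\cdot(y\cdot z)$; $x\cdot y=y\cdot x$; $1\cdot x=x$; $x\cdot(y+z)=x\cdot y+x\cdot z$; $-(-x)=x$;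 $0\cdot(x\cdot x)=0\cdot x$; $(x^{-1})^{-1}=x+0\cdot x^{-1}$; $x\cdot x^{-1}=1+0\cdot x^{-1}$; $(x\cdot y)^{-1}=x^{-1}\cdot y^{-1}$; $1^{-1}=1$; $0^{-1}=\mathbf a$; $x+\mathbf a=\mathbf a$; $x\cdot\mathbf a=\mathbf a$. *)

theory Defs
  imports "HOL-Algebra.Ring"
begin

definition reduced :: "('a, 'm) ring_scheme \<Rightarrow> bool" where
  "reduced R \<longleftrightarrow> (\<forall>x\<in>carrier R. x \<otimes>\<^bsub>R\<^esub> x = \<zero>\<^bsub>R\<^esub> \<longrightarrow> x = \<zero>\<^bsub>R\<^esub>)"


(* The additive and multiplicative inverse are separate operations of the signature here: the
   a_inv and m_inv of HOL-Algebra are derived from group structure, which is not available. *)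
record 'a cm_algebra = "'a ring" +
  cm_neg :: "'a \<Rightarrow> 'a" ("(\<midarrow>\<index> _)" [81] 80)
  cm_inv :: "'a \<Rightarrow> 'a" ("(recip\<index> _)" [81] 80)
  cm_err :: 'a ("\<^bold>a\<index>")

locale common_meadow =
  fixes M :: "('a, 'm) cm_algebra_scheme" (structure)
  assumes zero_closed: "\<zero> \<in> carrier M"
    and one_closed: "\<one> \<in> carrier M"
    and err_closed: "\<^bold>a \<in> carrier M"
    and neg_closed: "x \<in> carrier M \<Longrightarrow> \<midarrow> x \<in> carrier M"
    and recip_closed: "x \<in> carrier M \<Longrightarrow> recip x \<in> carrier M"
    and add_closed: "\<lbrakk>x \<in> carrier M; y \<in> carrier M\<rbrakk> \<Longrightarrow> x \<oplus> y \<in> carrier M"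
    and mult_closed: "\<lbrakk>x \<in> carrier M; y \<in> carrier M\<rbrakk> \<Longrightarrow> x \<otimes> y \<in> carrier M"
    and add_assoc: "\<lbrakk>x \<in> carrier M; y \<in> carrier M; z \<in> carrier M\<rbrakk>
          \<Longrightarrow> (x \<oplus> y) \<oplus> z = x \<oplus> (y \<oplus> z)"
    and add_comm: "\<lbrakk>x \<in> carrier M; y \<in> carrier M\<rbrakk> \<Longrightarrow> x \<oplus> y = y \<oplus> x"
    and add_zero: "x \<in> carrier M \<Longrightarrow> x \<oplus> \<zero> = x"
    and add_neg: "x \<in> carrier M \<Longrightarrow> x \<oplus> (\<midarrow> x) = \<zero> \<otimes> x"
    and mult_assoc: "\<lbrakk>x \<in> carrier M; y \<in> carrier M; z \<in> carrier M\<rbrakk>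
          \<Longrightarrow> (x \<otimes> y) \<otimes> z = x \<otimes> (y \<otimes> z)"
    and mult_comm: "\<lbrakk>x \<in> carrier M; y \<in> carrier M\<rbrakk> \<Longrightarrow> x \<otimes> y = y \<otimes> x"
    and one_mult: "x \<in> carrier M \<Longrightarrow> \<one> \<otimes> x = x"
    and distrib: "\<lbrakk>x \<in> carrier M; y \<in> carrier M; z \<in> carrier M\<rbrakk>
          \<Longrightarrow> x \<otimes> (y \<oplus> z) = (x \<otimes> y) \<oplus> (x \<otimes> z)"
    and neg_neg: "x \<in> carrier M \<Longrightarrow> \<midarrow> (\<midarrow> x) = x"
    and zero_mult_square: "x \<in> carrier M \<Longrightarrow> \<zero> \<otimes> (x \<otimes> x) = \<zero> \<otimes> x"
    and recip_recip: "x \<in> carrier M \<Longrightarrow> recip (recip x) = x \<oplus> (\<zero> \<otimes> (recip x))"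
    and mult_recip: "x \<in> carrier M \<Longrightarrow> x \<otimes> (recip x) = \<one> \<oplus> (\<zero> \<otimes> (recip x))"
    and recip_mult: "\<lbrakk>x \<in> carrier M; y \<in> carrier M\<rbrakk>
          \<Longrightarrow> recip (x \<otimes> y) = (recip x) \<otimes> (recip y)"
    and recip_one: "recip \<one> = \<one>"
    and recip_zero: "recip \<zero> = \<^bold>a"
    and add_err: "x \<in> carrier M \<Longrightarrow> x \<oplus> \<^bold>a = \<^bold>a"
    and mult_err: "x \<in> carrier M \<Longrightarrow> x \<otimes> \<^bold>a = \<^bold>a"


(* The fracpair p/q is the pair (p, q). *)
definition fracpairs :: "('a, 'm) ring_scheme \<Rightarrow> ('a \<times> 'a) set" where
  "fracpairs R = carrier R \<times> carrier R"

definition fp_add :: "('a, 'm) ring_scheme \<Rightarrow> 'a \<times> 'a \<Rightarrow> 'a \<times> 'a \<Rightarrow> 'a \<times> 'a" where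
  "fp_add R = (\<lambda>(x, y) (u, v). ((x \<otimes>\<^bsub>R\<^esub> v) \<oplus>\<^bsub>R\<^esub> (u \<otimes>\<^bsub>R\<^esub> y), y \<otimes>\<^bsub>R\<^esub> v))"

definition fp_mult :: "('a, 'm) ring_scheme \<Rightarrow> 'a \<times> 'a \<Rightarrow> 'a \<times> 'a \<Rightarrow> 'a \<times> 'a" where
  "fp_mult R = (\<lambda>(x, y) (u, v). (x \<otimes>\<^bsub>R\<^esub> u, y \<otimes>\<^bsub>R\<^esub> v))"

definition fp_neg :: "('a, 'm) ring_scheme \<Rightarrow> 'a \<times> 'a \<Rightarrow> 'a \<times> 'a" where
  "fp_neg R = (\<lambda>(x, y). (\<ominus>\<^bsub>R\<^esub> x, y))"

definition fp_inv :: "('a, 'm) ring_scheme \<Rightarrow> 'a \<times> 'a \<Rightarrow> 'a \<times> 'a" where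
  "fp_inv R = (\<lambda>(x, y). (y \<otimes>\<^bsub>R\<^esub> y, x \<otimes>\<^bsub>R\<^esub> y))"

inductive_set cc_rel :: "('a, 'm) ring_scheme \<Rightarrow> (('a \<times> 'a) \<times> ('a \<times> 'a)) set"
  for R (structure) where
  cancel: "\<lbrakk>x \<in> carrier R; y \<in> carrier R; z \<in> carrier R\<rbrakk>
    \<Longrightarrow> ((x \<otimes> z, y \<otimes> (z \<otimes> z)), (x, y \<otimes> z)) \<in> cc_rel R"
| refl: "p \<in> fracpairs R \<Longrightarrow> (p, p) \<in> cc_rel R"
| sym: "(p, q) \<in> cc_rel R \<Longrightarrow> (q, p) \<in> cc_rel R"
| trans: "\<lbrakk>(p, q) \<in> cc_rel R; (q, r) \<in> cc_rel R\<rbrakk> \<Longrightarrow> (p, r) \<in> cc_rel R"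

abbreviation cc_class :: "('a, 'm) ring_scheme \<Rightarrow> 'a \<times> 'a \<Rightarrow> ('a \<times> 'a) set" where
  "cc_class R p \<equiv> cc_rel R `` {p}"

(* An operation on classes is the union, over all representatives, of the class of the result;
   by the congruence lemmas below this is a single class. *)
definition F_cm :: "('a, 'm) ring_scheme \<Rightarrow> ('a \<times> 'a) set cm_algebra" where
  "F_cm R = \<lparr>
    carrier = fracpairs R // cc_rel R,
    monoid.mult = (\<lambda>A B. \<Union>p\<in>A. \<Union>q\<in>B. cc_class R (fp_mult R p q)),
    one = cc_class R (\<one>\<^bsub>R\<^esub>, \<one>\<^bsub>R\<^esub>),
    zero = cc_class R (\<zero>\<^bsub>R\<^esub>, \<one>\<^bsub>R\<^esub>),
    add = (\<lambda>A B. \<Union>p\<in>A. \<Union>q\<in>B. cc_class R (fp_add R p q)),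
    cm_neg = (\<lambda>A. \<Union>p\<in>A. cc_class R (fp_neg R p)),
    cm_inv = (\<lambda>A. \<Union>p\<in>A. cc_class R (fp_inv R p)),
    cm_err = cc_class R (\<one>\<^bsub>R\<^esub>, \<zero>\<^bsub>R\<^esub>)\<rparr>"


context cring
begin

lemma cc_rel_subset: "cc_rel R \<subseteq> fracpairs R \<times> fracpairs R"
proof -
  have "p \<in> fracpairs R \<and> q \<in> fracpairs R" if "(p, q) \<in> cc_rel R" for p q
    using that by induction (auto simp: fracpairs_def)
  then show ?thesis by auto
qed

lemma equiv_cc_rel: "equiv (fracpairs R) (cc_rel R)"
  by (rule equivI)
    (use cc_rel_subset in \<open>auto simp: refl_on_def intro!: symI transI intro: cc_rel.intros\<close>)

lemma cc_rel_least:
  assumes "equiv (fracpairs R) E"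
    and "\<And>x y z. \<lbrakk>x \<in> carrier R; y \<in> carrier R; z \<in> carrier R\<rbrakk>
      \<Longrightarrow> ((x \<otimes> z, y \<otimes> (z \<otimes> z)), (x, y \<otimes> z)) \<in> E"
  shows "cc_rel R \<subseteq> E"
proof -
  have "(p, q) \<in> E" if "(p, q) \<in> cc_rel R" for p q
    using that
  proof induction
    case (cancel x y z) then show ?case using assms(2) by blast
  next
    case (refl p) then show ?case using assms(1) by (auto simp: equiv_def refl_on_def)
  next
    case (sym p q) then show ?case using assms(1) by (meson equiv_def symD)
  next
    case (trans p q r) then show ?case using assms(1) by (meson equiv_def transD)
  qed
  then show ?thesis by auto
qed

lemma cc_cancel:
  assumes "x \<in> carrier R" "y \<in> carrier R" "z \<in> carrier R"
    and "a = x \<otimes> z" "b = y \<otimes> (z \<otimes> z)" "d = y \<otimes> z"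
  shows "((a, b), (x, d)) \<in> cc_rel R"
  using cc_rel.cancel[of x R y z] assms by simp

lemma cc_rel_lift:
  assumes "(p, q) \<in> cc_rel R"
    and clo: "\<And>p. p \<in> fracpairs R \<Longrightarrow> f p \<in> fracpairs R"
    and gen: "\<And>x y z. \<lbrakk>x \<in> carrier R; y \<in> carrier R; z \<in> carrier R\<rbrakk>
      \<Longrightarrow> (f (x \<otimes> z, y \<otimes> (z \<otimes> z)), f (x, y \<otimes> z)) \<in> cc_rel R"
  shows "(f p, f q) \<in> cc_rel R"
  using assms(1)
  by induction (auto intro: gen clo cc_rel.refl cc_rel.sym cc_rel.trans)

lemma cc_rel_neg:
  "(p, q) \<in> cc_rel R \<Longrightarrow> (fp_neg R p, fp_neg R q) \<in> cc_rel R"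
proof (erule cc_rel_lift)
  fix x y z assume [simp]: "x \<in> carrier R" "y \<in> carrier R" "z \<in> carrier R"
  show "(fp_neg R (x \<otimes> z, y \<otimes> (z \<otimes> z)), fp_neg R (x, y \<otimes> z)) \<in> cc_rel R"
    unfolding fp_neg_def prod.case
    by (rule cc_cancel[where y = y and z = z]) (simp_all add: l_minus)
qed (auto simp: fracpairs_def fp_neg_def)

lemma cc_rel_inv:
  "(p, q) \<in> cc_rel R \<Longrightarrow> (fp_inv R p, fp_inv R q) \<in> cc_rel R"
proof (erule cc_rel_lift)
  fix x y z assume [simp]: "x \<in> carrier R" "y \<in> carrier R" "z \<in> carrier R"
  let ?n = "(y \<otimes> z) \<otimes> (y \<otimes> z)"
  have "((?n \<otimes> z \<otimes> z, (x \<otimes> y \<otimes> z) \<otimes> (z \<otimes> z)), (?n \<otimes> z, (x \<otimes> y) \<otimes> (z \<otimes> z))) \<in> cc_rel R"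
    by (rule cc_cancel[where y = "x \<otimes> y \<otimes> z" and z = z]) (simp_all add: m_ac)
  moreover have "((?n \<otimes> z, (x \<otimes> y) \<otimes> (z \<otimes> z)), (?n, x \<otimes> y \<otimes> z)) \<in> cc_rel R"
    by (rule cc_cancel[where y = "x \<otimes> y" and z = z]) simp_all
  ultimately have "((?n \<otimes> z \<otimes> z, (x \<otimes> y \<otimes> z) \<otimes> (z \<otimes> z)), (?n, x \<otimes> y \<otimes> z)) \<in> cc_rel R"
    by (rule cc_rel.trans)
  then show "(fp_inv R (x \<otimes> z, y \<otimes> (z \<otimes> z)), fp_inv R (x, y \<otimes> z)) \<in> cc_rel R"
    by (simp add: fp_inv_def m_ac)
qed (auto simp: fracpairs_def fp_inv_def)

lemma fp_add_commute:
  "\<lbrakk>p \<in> fracpairs R; q \<in> fracpairs R\<rbrakk> \<Longrightarrow> fp_add R p q = fp_add R q p"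
  by (auto simp: fracpairs_def fp_add_def a_comm m_comm)

lemma fp_mult_commute:
  "\<lbrakk>p \<in> fracpairs R; q \<in> fracpairs R\<rbrakk> \<Longrightarrow> fp_mult R p q = fp_mult R q p"
  by (auto simp: fracpairs_def fp_mult_def m_comm)

lemma cc_rel_add_left:
  assumes "(p, q) \<in> cc_rel R" "r \<in> fracpairs R"
  shows "(fp_add R p r, fp_add R q r) \<in> cc_rel R"
  using assms(1)
proof (rule cc_rel_lift)
  obtain u v where r: "r = (u, v)" and [simp]: "u \<in> carrier R" "v \<in> carrier R"
    using assms(2) by (auto simp: fracpairs_def)
  show "fp_add R p r \<in> fracpairs R" if "p \<in> fracpairs R" for p
    using that by (auto simp: fracpairs_def fp_add_def r)
  fix x y z assume [simp]: "x \<in> carrier R" "y \<in> carrier R" "z \<in> carrier R"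
  show "(fp_add R (x \<otimes> z, y \<otimes> (z \<otimes> z)) r, fp_add R (x, y \<otimes> z) r) \<in> cc_rel R"
    unfolding fp_add_def r prod.case
    by (rule cc_cancel[where y = "y \<otimes> v" and z = z]) (simp_all add: m_ac l_distr r_distr)
qed

lemma cc_rel_mult_left:
  assumes "(p, q) \<in> cc_rel R" "r \<in> fracpairs R"
  shows "(fp_mult R p r, fp_mult R q r) \<in> cc_rel R"
  using assms(1)
proof (rule cc_rel_lift)
  obtain u v where r: "r = (u, v)" and [simp]: "u \<in> carrier R" "v \<in> carrier R"
    using assms(2) by (auto simp: fracpairs_def)
  show "fp_mult R p r \<in> fracpairs R" if "p \<in> fracpairs R" for p
    using that by (auto simp: fracpairs_def fp_mult_def r)
  fix x y z assume [simp]: "x \<in> carrier R" "y \<in> carrier R" "z \<in> carrier R"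
  show "(fp_mult R (x \<otimes> z, y \<otimes> (z \<otimes> z)) r, fp_mult R (x, y \<otimes> z) r) \<in> cc_rel R"
    unfolding fp_mult_def r prod.case
    by (rule cc_cancel[where y = "y \<otimes> v" and z = z]) (simp_all add: m_ac)
qed

lemma cc_rel_add:
  assumes "(p, p') \<in> cc_rel R" "(q, q') \<in> cc_rel R"
  shows "(fp_add R p q, fp_add R p' q') \<in> cc_rel R"
proof -
  have F: "p \<in> fracpairs R" "p' \<in> fracpairs R" "q \<in> fracpairs R" "q' \<in> fracpairs R"
    using assms cc_rel_subset by auto
  show ?thesis
    using cc_rel_add_left[OF assms(1) F(3)] cc_rel_add_left[OF assms(2) F(2)]
    by (metis F cc_rel.trans fp_add_commute)
qed

lemma cc_rel_mult:
  assumes "(p, p') \<in> cc_rel R" "(q, q') \<in> cc_rel R"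
  shows "(fp_mult R p q, fp_mult R p' q') \<in> cc_rel R"
proof -
  have F: "p \<in> fracpairs R" "p' \<in> fracpairs R" "q \<in> fracpairs R" "q' \<in> fracpairs R"
    using assms cc_rel_subset by auto
  show ?thesis
    using cc_rel_mult_left[OF assms(1) F(3)] cc_rel_mult_left[OF assms(2) F(2)]
    by (metis F cc_rel.trans fp_mult_commute)
qed

end

end

theory Submission
  imports Defs
begin

text \<open>Most axioms hold as identities of pairs. The others need a single cancellation step
  \<open>(x z, y (z z)) = (x, y z)\<close>, whose witness \<open>z\<close> is the denominator of the argument, except
  in \<open>(y, 0) = (1, 0)\<close>, where \<open>z\<close> is the numerator because the denominator \<open>0\<close> absorbs it.\<close>

context cring
begin

lemma fp_closed:
  "(\<one>, \<zero>) \<in> fracpairs R" "(\<zero>, \<one>) \<in> fracpairs R" "(\<one>, \<one>) \<in> fracpairs R"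
  "p \<in> fracpairs R \<Longrightarrow> fp_neg R p \<in> fracpairs R"
  "p \<in> fracpairs R \<Longrightarrow> fp_inv R p \<in> fracpairs R"
  "\<lbrakk>p \<in> fracpairs R; q \<in> fracpairs R\<rbrakk> \<Longrightarrow> fp_add R p q \<in> fracpairs R"
  "\<lbrakk>p \<in> fracpairs R; q \<in> fracpairs R\<rbrakk> \<Longrightarrow> fp_mult R p q \<in> fracpairs R"
  by (auto simp: fracpairs_def fp_neg_def fp_inv_def fp_add_def fp_mult_def)

lemma cc_class_eq: "(p, q) \<in> cc_rel R \<Longrightarrow> cc_class R p = cc_class R q"
  by (rule equiv_class_eq[OF equiv_cc_rel])

lemma F_cm_carrier: "carrier (F_cm R) = cc_class R ` fracpairs R"
  by (auto simp: F_cm_def quotient_def)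

lemma F_cm_consts:
  "\<one>\<^bsub>F_cm R\<^esub> = cc_class R (\<one>, \<one>)"
  "\<zero>\<^bsub>F_cm R\<^esub> = cc_class R (\<zero>, \<one>)"
  "\<^bold>a\<^bsub>F_cm R\<^esub> = cc_class R (\<one>, \<zero>)"
  by (simp_all add: F_cm_def)

text \<open>By congruence all representatives contribute the same class to the union, so it can be
  evaluated at any one of them. The next three rules follow likewise, with congruence in both
  arguments for the binary operations.\<close>

lemma F_cm_neg:
  "p \<in> fracpairs R \<Longrightarrow> \<midarrow>\<^bsub>F_cm R\<^esub> (cc_class R p) = cc_class R (fp_neg R p)"
  unfolding F_cm_def cm_algebra.simps
  by (rule UN_equiv_class[OF equiv_cc_rel]) (assumption | intro congruentI cc_class_eq cc_rel_neg)+

lemma F_cm_recip: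
  "p \<in> fracpairs R \<Longrightarrow> recip\<^bsub>F_cm R\<^esub> (cc_class R p) = cc_class R (fp_inv R p)"
  unfolding F_cm_def cm_algebra.simps
  by (rule UN_equiv_class[OF equiv_cc_rel]) (assumption | intro congruentI cc_class_eq cc_rel_inv)+

lemma F_cm_add:
  "\<lbrakk>p \<in> fracpairs R; q \<in> fracpairs R\<rbrakk>
    \<Longrightarrow> cc_class R p \<oplus>\<^bsub>F_cm R\<^esub> cc_class R q = cc_class R (fp_add R p q)"
  unfolding F_cm_def ring.simps
  by (rule UN_equiv_class2[OF equiv_cc_rel equiv_cc_rel])
    (assumption | intro congruent2I' cc_class_eq cc_rel_add)+

lemma F_cm_mult:
  "\<lbrakk>p \<in> fracpairs R; q \<in> fracpairs R\<rbrakk>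
    \<Longrightarrow> cc_class R p \<otimes>\<^bsub>F_cm R\<^esub> cc_class R q = cc_class R (fp_mult R p q)"
  unfolding F_cm_def monoid.simps
  by (rule UN_equiv_class2[OF equiv_cc_rel equiv_cc_rel])
    (assumption | intro congruent2I' cc_class_eq cc_rel_mult)+

text \<open>As rewrite rules these push every operation inside a single \<open>cc_class\<close>;
  \<open>fp_closed\<close> discharges the membership premises for compound pairs.\<close>

lemmas F_cm_ops = F_cm_consts F_cm_neg F_cm_recip F_cm_add F_cm_mult fp_closed

text \<open>Needed because \<open>A + (-A)\<close> and \<open>0 (A A)\<close> compute to denominator
  \<open>y y\<close>, but \<open>0 A\<close> to denominator \<open>y\<close>.\<close>

lemma cc_zero_square:
  "y \<in> carrier R \<Longrightarrow> ((\<zero>, y \<otimes> y), (\<zero>, y)) \<in> cc_rel R"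
  by (rule cc_cancel[where y = \<one> and z = y]) simp_all

text \<open>This makes \<open>a\<close> absorbing: a sum or product with \<open>(1, 0)\<close> has
  denominator \<open>0\<close>, and its numerator can then be discarded.\<close>

lemma cc_over_zero:
  "x \<in> carrier R \<Longrightarrow> ((x, \<zero>), (\<one>, \<zero>)) \<in> cc_rel R"
  by (rule cc_cancel[where y = \<zero> and z = x]) simp_all

text \<open>Axioms are grouped by their number of variables: representatives of \<open>A\<close>,
  \<open>B\<close>, \<open>C\<close> are chosen in turn, and the constants come last.\<close>

lemma common_meadow_F_cm: "common_meadow (F_cm R)"
proof
  fix A assume "A \<in> carrier (F_cm R)"
  then obtain x y where A: "A = cc_class R (x, y)" and p: "(x, y) \<in> fracpairs R"
    unfolding F_cm_carrier by auto
  then have [simp]: "x \<in> carrier R" "y \<in> carrier R" by (auto simp: fracpairs_def)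
  show "\<midarrow>\<^bsub>F_cm R\<^esub> A \<in> carrier (F_cm R)" "recip\<^bsub>F_cm R\<^esub> A \<in> carrier (F_cm R)"
    by (simp_all add: A p F_cm_ops F_cm_carrier)
  show "A \<oplus>\<^bsub>F_cm R\<^esub> \<zero>\<^bsub>F_cm R\<^esub> = A"
    \<comment> \<open>The first \<open>simp\<close> keeps the pair operations folded so that
      \<open>fp_closed\<close> applies; the second computes in \<open>R\<close>. Later axioms follow
      the same pattern.\<close>
    by (simp add: A p F_cm_ops) (simp add: fp_add_def)
  show "\<one>\<^bsub>F_cm R\<^esub> \<otimes>\<^bsub>F_cm R\<^esub> A = A"
    by (simp add: A p F_cm_ops) (simp add: fp_mult_def)
  show "\<midarrow>\<^bsub>F_cm R\<^esub> (\<midarrow>\<^bsub>F_cm R\<^esub> A) = A"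
    by (simp add: A p F_cm_ops) (simp add: fp_neg_def)
  show "A \<oplus>\<^bsub>F_cm R\<^esub> (\<midarrow>\<^bsub>F_cm R\<^esub> A) = \<zero>\<^bsub>F_cm R\<^esub> \<otimes>\<^bsub>F_cm R\<^esub> A"
    by (simp add: A p F_cm_ops)
      (simp add: fp_add_def fp_mult_def fp_neg_def l_minus r_neg cc_class_eq[OF cc_zero_square])
  show "\<zero>\<^bsub>F_cm R\<^esub> \<otimes>\<^bsub>F_cm R\<^esub> (A \<otimes>\<^bsub>F_cm R\<^esub> A) = \<zero>\<^bsub>F_cm R\<^esub> \<otimes>\<^bsub>F_cm R\<^esub> A"
    by (simp add: A p F_cm_ops) (simp add: fp_mult_def cc_class_eq[OF cc_zero_square])
  show "A \<oplus>\<^bsub>F_cm R\<^esub> \<^bold>a\<^bsub>F_cm R\<^esub> = \<^bold>a\<^bsub>F_cm R\<^esub>"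
    \<comment> \<open>The numerator of the sum is \<open>x 0 + 1 y = y\<close>.\<close>
    by (simp add: A p F_cm_ops) (simp add: fp_add_def cc_class_eq[OF cc_over_zero[of y]])
  show "A \<otimes>\<^bsub>F_cm R\<^esub> \<^bold>a\<^bsub>F_cm R\<^esub> = \<^bold>a\<^bsub>F_cm R\<^esub>"
    by (simp add: A p F_cm_ops) (simp add: fp_mult_def cc_class_eq[OF cc_over_zero[of x]])
  \<comment> \<open>Since \<open>recip A\<close> is \<open>(y y, x y)\<close>, the term
    \<open>0 (recip A)\<close> is \<open>(0, x y)\<close>, and adding \<open>1\<close> gives
    \<open>(x y, x y)\<close>.\<close>
  have "((x \<otimes> (y \<otimes> y), y \<otimes> (x \<otimes> y)), (x \<otimes> y, x \<otimes> y)) \<in> cc_rel R"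
    by (rule cc_cancel[where y = x and z = y]) (simp_all add: m_ac)
  from cc_class_eq[OF this] show "A \<otimes>\<^bsub>F_cm R\<^esub> (recip\<^bsub>F_cm R\<^esub> A)
      = \<one>\<^bsub>F_cm R\<^esub> \<oplus>\<^bsub>F_cm R\<^esub> (\<zero>\<^bsub>F_cm R\<^esub> \<otimes>\<^bsub>F_cm R\<^esub> (recip\<^bsub>F_cm R\<^esub> A))"
    by (simp add: A p F_cm_ops) (simp add: fp_add_def fp_mult_def fp_inv_def)
  \<comment> \<open>The left pair is the double inverse, the right one is
    \<open>(x, y) + (0, x y)\<close>; they differ by one factor \<open>y\<close>.\<close>
  have "(((x \<otimes> y) \<otimes> (x \<otimes> y), (y \<otimes> y) \<otimes> (x \<otimes> y)), (x \<otimes> (x \<otimes> y), y \<otimes> (x \<otimes> y))) \<in> cc_rel R"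
    by (rule cc_cancel[where y = "x \<otimes> y" and z = y]) (simp_all add: m_ac)
  from cc_class_eq[OF this] show "recip\<^bsub>F_cm R\<^esub> (recip\<^bsub>F_cm R\<^esub> A)
      = A \<oplus>\<^bsub>F_cm R\<^esub> (\<zero>\<^bsub>F_cm R\<^esub> \<otimes>\<^bsub>F_cm R\<^esub> (recip\<^bsub>F_cm R\<^esub> A))"
    by (simp add: A p F_cm_ops) (simp add: fp_add_def fp_mult_def fp_inv_def)

  fix B assume "B \<in> carrier (F_cm R)"
  then obtain u v where B: "B = cc_class R (u, v)" and q: "(u, v) \<in> fracpairs R"
    unfolding F_cm_carrier by auto
  then have [simp]: "u \<in> carrier R" "v \<in> carrier R" by (auto simp: fracpairs_def)
  show "A \<oplus>\<^bsub>F_cm R\<^esub> B \<in> carrier (F_cm R)" "A \<otimes>\<^bsub>F_cm R\<^esub> B \<in> carrier (F_cm R)"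
    by (simp_all add: A B p q F_cm_ops F_cm_carrier)
  show "A \<oplus>\<^bsub>F_cm R\<^esub> B = B \<oplus>\<^bsub>F_cm R\<^esub> A"
    by (simp add: A B p q F_cm_ops fp_add_commute)
  show "A \<otimes>\<^bsub>F_cm R\<^esub> B = B \<otimes>\<^bsub>F_cm R\<^esub> A"
    by (simp add: A B p q F_cm_ops fp_mult_commute)
  show "recip\<^bsub>F_cm R\<^esub> (A \<otimes>\<^bsub>F_cm R\<^esub> B) = (recip\<^bsub>F_cm R\<^esub> A) \<otimes>\<^bsub>F_cm R\<^esub> (recip\<^bsub>F_cm R\<^esub> B)"
    by (simp add: A B p q F_cm_ops) (simp add: fp_mult_def fp_inv_def m_ac)

  fix C assume "C \<in> carrier (F_cm R)"
  then obtain s t where C: "C = cc_class R (s, t)" and r: "(s, t) \<in> fracpairs R"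
    unfolding F_cm_carrier by auto
  then have [simp]: "s \<in> carrier R" "t \<in> carrier R" by (auto simp: fracpairs_def)
  show "(A \<oplus>\<^bsub>F_cm R\<^esub> B) \<oplus>\<^bsub>F_cm R\<^esub> C = A \<oplus>\<^bsub>F_cm R\<^esub> (B \<oplus>\<^bsub>F_cm R\<^esub> C)"
    by (simp add: A B C p q r F_cm_ops) (simp add: fp_add_def l_distr r_distr a_ac m_ac)
  show "(A \<otimes>\<^bsub>F_cm R\<^esub> B) \<otimes>\<^bsub>F_cm R\<^esub> C = A \<otimes>\<^bsub>F_cm R\<^esub> (B \<otimes>\<^bsub>F_cm R\<^esub> C)"
    by (simp add: A B C p q r F_cm_ops) (simp add: fp_mult_def m_ac)
  \<comment> \<open>Adding \<open>A B\<close> and \<open>A C\<close> uses the denominator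
    \<open>y\<close> of \<open>A\<close> twice, which leaves a surplus factor \<open>y\<close> above
    and below.\<close>
  have "(((x \<otimes> u) \<otimes> (y \<otimes> t) \<oplus> (x \<otimes> s) \<otimes> (y \<otimes> v), (y \<otimes> v) \<otimes> (y \<otimes> t)),
      (x \<otimes> (u \<otimes> t \<oplus> s \<otimes> v), y \<otimes> (v \<otimes> t))) \<in> cc_rel R"
    by (rule cc_cancel[where y = "v \<otimes> t" and z = y]) (simp_all add: l_distr r_distr m_ac)
  from cc_class_eq[OF this] show "A \<otimes>\<^bsub>F_cm R\<^esub> (B \<oplus>\<^bsub>F_cm R\<^esub> C) = (A \<otimes>\<^bsub>F_cm R\<^esub> B) \<oplus>\<^bsub>F_cm R\<^esub> (A \<otimes>\<^bsub>F_cm R\<^esub> C)"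
    by (simp add: A B C p q r F_cm_ops) (simp add: fp_add_def fp_mult_def)
next
  show "\<zero>\<^bsub>F_cm R\<^esub> \<in> carrier (F_cm R)" "\<one>\<^bsub>F_cm R\<^esub> \<in> carrier (F_cm R)"
    "\<^bold>a\<^bsub>F_cm R\<^esub> \<in> carrier (F_cm R)"
    by (simp_all add: F_cm_ops F_cm_carrier)
  show "recip\<^bsub>F_cm R\<^esub> \<one>\<^bsub>F_cm R\<^esub> = \<one>\<^bsub>F_cm R\<^esub>" "recip\<^bsub>F_cm R\<^esub> \<zero>\<^bsub>F_cm R\<^esub> = \<^bold>a\<^bsub>F_cm R\<^esub>"
    by (simp_all add: F_cm_ops) (simp_all add: fp_inv_def)
qed

end

theorem theorem2p3p2:
  fixes R :: "('a, 'm) ring_scheme"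
  assumes "cring R" and "reduced R"
  shows "common_meadow (F_cm R)"
  using cring.common_meadow_F_cm[OF assms(1)] .

end
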